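(* Let $\varepsilon>0$ and $\delta\in(0,1)$. Assume all features satisfy $\|x_a\|_2\le 1$ (enforced by clipping) and all rewards satisfy $r_t\in[0,1]$, and let the batch schedule, i.e. the sequence of batch sizes $\{B_k\}_{k=1}^K$, be data-independent. Then the algorithm AdaPrivate-TS (defined in the context) run with target $(\varepsilon,\delta)$ satisfies event-level $(\varepsilon,\delta)$-differential privacy for the action transcript: for all adjacent datasets $D\sim D'$ and all measurable sets $E$ of transcripts, $$\Pr\bigl[(a_1,\dots,a_T)(D)\in E\bigr]\le e^{\varepsilon}\,\Pr\bigl[(a_1,\dots,a_T)(D')\in E\bigr]+\delta.$$
   Context: Setting. At round $t\in\{1,\dots,T\}$ the learner observes a candidate set $\mathcal{A}_t$ of arms with public feature vectors $x_a=x_{t,a}\in\mathbb{R}^d$, $a\in\mathcal{A}_t$, selects $a_t\in\mathcal{A}_t$, and receives a reward $r_t$. Adjacency (event-level). An interaction dataset $D=\{(u_t,r_t)\}_{t=1}^T$ records the user identity $u_t$ and the reward $r_t$ at each round. Two datasets $D,D'$ are adjacent, $D\sim D'$, if they differ in exactly one entry $(u_t,r_t)\ne(u_t',r_t')$ for a single index $t$, all other entries being identical. The features are public and not part of the dataset; actions $a_t$ are outputs of the algorithm and not part of the adjacency relation. The algorithm run on $D$ receives reward $r_t$ from $D$ at round $t$. Algorithm AdaPrivate-TS. Given target $(\varepsilon,\delta)$, set $\rho=\bigl(\sqrt{\varepsilon+\log(1/\delta)}-\sqrt{\log(1/\delta)}\bigr)^2$ and $\sigma=1/\sqrt{2\rho}$.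 Other (data-independent) parameters: ridge parameter $\lambda>0$, prior vector $\theta_0\in\mathbb{R}^d$, exploration scales $v_k>0$ of the form $v_k=v_0\gamma^{k-1}$ with $v_0,\gamma>0$. Rounds $1,\dots,T$ are divided into consecutive batches $k=1,\dots,K$ of sizes $B_k$. Initialize $A\leftarrow\lambda I_d$, $b\leftarrow\lambda\theta_0$, batch sum $s\leftarrow0$, $k\leftarrow1$. At each round $t$ (in batch $k$): replace each feature $x_a$ by $x_a/\max(1,\|x_a\|_2)$; draw, with fresh randomness, $\tilde\theta\sim\mathcal{N}(A^{-1}b,\,v_k^2A^{-1})$; play $a_t\in\arg\max_{a\in\mathcal{A}_t}x_a^\top\tilde\theta$; observe $r_t$; update $A\leftarrow A+x_{a_t}x_{a_t}^\top$ and $s\leftarrow s+r_tx_{a_t}$. At the end of batch $k$, set $b\leftarrow b+s+\eta_k$ with fresh independent $\eta_k\sim\mathcal{N}(0,\sigma^2I_d)$, reset $s\leftarrow0$, and set $k\leftarrow k+1$. Thus $b$ changes only at batch boundaries, while $A$ is updated every round. *)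

theory Defs
  imports "HOL-Probability.Probability"
begin

text \<open>
  Conventions. Rounds and batches are numbered from 1. A dataset is a function \<open>D\<close> with
  \<open>D t = (u\<^sub>t, r\<^sub>t)\<close>, of which only the entries \<open>t \<in> {1..T}\<close> matter. The candidate set of
  round \<open>t\<close> is a measurable space \<open>C t\<close>: its arms are \<open>space (C t)\<close>, and for a finite set of arms
  one takes \<open>C t\<close> to be a counting space. An action history after \<open>t\<close> rounds is an element of the
  product space over \<open>{1..t}\<close>.
\<close>

definition adjacent :: "nat \<Rightarrow> (nat \<Rightarrow> 'u \<times> real) \<Rightarrow> (nat \<Rightarrow> 'u \<times> real) \<Rightarrow> bool" where
  "adjacent T D D' \<longleftrightarrow> (\<exists>t\<in>{1..T}. D t \<noteq> D' t \<and> (\<forall>i\<in>{1..T} - {t}. D i = D' i))"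

definition zcdp_rho :: "real \<Rightarrow> real \<Rightarrow> real" where
  "zcdp_rho \<epsilon> \<delta> = (sqrt (\<epsilon> + ln (1 / \<delta>)) - sqrt (ln (1 / \<delta>)))\<^sup>2"

definition noise_sd :: "real \<Rightarrow> real \<Rightarrow> real" where
  "noise_sd \<epsilon> \<delta> = 1 / sqrt (2 * zcdp_rho \<epsilon> \<delta>)"

text \<open>The normal distribution on \<open>\<real>\<^sup>d\<close>, only meaningful for positive definite \<open>\<Sigma>\<close>.\<close>

definition mv_normal :: "real ^ 'd \<Rightarrow> real ^ 'd ^ 'd \<Rightarrow> (real ^ 'd) measure" where
  "mv_normal \<mu> \<Sigma> = density lborel (\<lambda>z. ennreal
     (exp (- ((z - \<mu>) \<bullet> (matrix_inv \<Sigma> *v (z - \<mu>))) / 2) / sqrt ((2 * pi) ^ CARD('d) * det \<Sigma>)))"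

definition clip :: "real ^ 'd \<Rightarrow> real ^ 'd" where
  "clip v = v /\<^sub>R max 1 (norm v)"

definition outer :: "real ^ 'd \<Rightarrow> real ^ 'd ^ 'd" where
  "outer v = (\<chi> i j. v $ i * v $ j)"

definition batch_end :: "(nat \<Rightarrow> nat) \<Rightarrow> nat \<Rightarrow> nat" where
  "batch_end B k = (\<Sum>j = 1..k. B j)"

definition batch_of :: "(nat \<Rightarrow> nat) \<Rightarrow> nat \<Rightarrow> nat" where
  "batch_of B t = (LEAST k. t \<le> batch_end B k)"

text \<open>
  The algorithm's variables \<open>A\<close> and \<open>s\<close> are functions of the actions played (and, for \<open>s\<close>, of the
  rewards), so they are given as such and not carried along as state: \<open>design\<close> is the value of \<open>A\<close>
  after \<open>t\<close> rounds, \<open>batch_sum\<close> the value of \<open>s\<close> when batch \<open>k\<close> ends.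
\<close>

definition design :: "real \<Rightarrow> (nat \<Rightarrow> 'a \<Rightarrow> real ^ 'd) \<Rightarrow> nat \<Rightarrow> (nat \<Rightarrow> 'a) \<Rightarrow> real ^ 'd ^ 'd" where
  "design l x t h = mat l + (\<Sum>i = 1..t. outer (clip (x i (h i))))"

definition batch_sum ::
  "(nat \<Rightarrow> nat) \<Rightarrow> (nat \<Rightarrow> 'a \<Rightarrow> real ^ 'd) \<Rightarrow> (nat \<Rightarrow> 'u \<times> real) \<Rightarrow> nat \<Rightarrow> (nat \<Rightarrow> 'a) \<Rightarrow> real ^ 'd" where
  "batch_sum B x D k h =
     (\<Sum>i\<in>{batch_end B (k - 1)<..batch_end B k}. snd (D i) *\<^sub>R clip (x i (h i)))"

definition state_space :: "(nat \<Rightarrow> 'a measure) \<Rightarrow> nat \<Rightarrow> ((nat \<Rightarrow> 'a) \<times> (real ^ 'd)) measure" where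
  "state_space C t = PiM {1..t} C \<Otimes>\<^sub>M borel"

text \<open>
  One round: \<open>h\<close> holds the actions of the rounds before \<open>t\<close> and \<open>b\<close> is the algorithm's vector \<open>b\<close>.
  The maximizer is drawn from \<open>sel t (h, \<theta>)\<close>, which resolves ties; a deterministic rule is a
  point mass.
\<close>

definition ts_round ::
  "real \<Rightarrow> real \<Rightarrow> (nat \<Rightarrow> 'a measure) \<Rightarrow> (nat \<Rightarrow> 'a \<Rightarrow> real ^ 'd) \<Rightarrow>
   (nat \<Rightarrow> (nat \<Rightarrow> 'a) \<times> (real ^ 'd) \<Rightarrow> 'a measure) \<Rightarrow> real \<Rightarrow> (nat \<Rightarrow> real) \<Rightarrow> (nat \<Rightarrow> nat) \<Rightarrow>
   (nat \<Rightarrow> 'u \<times> real) \<Rightarrow> nat \<Rightarrow> (nat \<Rightarrow> 'a) \<times> (real ^ 'd) \<Rightarrow> ((nat \<Rightarrow> 'a) \<times> (real ^ 'd)) measure" where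
  "ts_round \<epsilon> \<delta> C x sel l v B D t = (\<lambda>(h, b).
     let A = design l x (t - 1) h; k = batch_of B t in
     do {
       \<theta> \<leftarrow> mv_normal (matrix_inv A *v b) ((v k)\<^sup>2 *\<^sub>R matrix_inv A);
       a \<leftarrow> sel t (h, \<theta>);
       (let h' = h(t := a) in
        if t = batch_end B k
        then do {
          \<eta> \<leftarrow> mv_normal 0 (mat ((noise_sd \<epsilon> \<delta>)\<^sup>2));
          return (state_space C t) (h', b + batch_sum B x D k h' + \<eta>)
        }
        else return (state_space C t) (h', b))
     })"

primrec ts_law ::
  "real \<Rightarrow> real \<Rightarrow> (nat \<Rightarrow> 'a measure) \<Rightarrow> (nat \<Rightarrow> 'a \<Rightarrow> real ^ 'd) \<Rightarrow>
   (nat \<Rightarrow> (nat \<Rightarrow> 'a) \<times> (real ^ 'd) \<Rightarrow> 'a measure) \<Rightarrow> real \<Rightarrow> real ^ 'd \<Rightarrow> (nat \<Rightarrow> real) \<Rightarrow> (nat \<Rightarrow> nat) \<Rightarrow>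
   (nat \<Rightarrow> 'u \<times> real) \<Rightarrow> nat \<Rightarrow> ((nat \<Rightarrow> 'a) \<times> (real ^ 'd)) measure" where
  "ts_law \<epsilon> \<delta> C x sel l \<theta>0 v B D 0 = return (state_space C 0) (\<lambda>_. undefined, l *\<^sub>R \<theta>0)"
| "ts_law \<epsilon> \<delta> C x sel l \<theta>0 v B D (Suc t) =
     ts_law \<epsilon> \<delta> C x sel l \<theta>0 v B D t \<bind> ts_round \<epsilon> \<delta> C x sel l v B D (Suc t)"

definition ts_transcript ::
  "real \<Rightarrow> real \<Rightarrow> (nat \<Rightarrow> 'a measure) \<Rightarrow> (nat \<Rightarrow> 'a \<Rightarrow> real ^ 'd) \<Rightarrow>
   (nat \<Rightarrow> (nat \<Rightarrow> 'a) \<times> (real ^ 'd) \<Rightarrow> 'a measure) \<Rightarrow> real \<Rightarrow> real ^ 'd \<Rightarrow> (nat \<Rightarrow> real) \<Rightarrow> (nat \<Rightarrow> nat) \<Rightarrow>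
   nat \<Rightarrow> (nat \<Rightarrow> 'u \<times> real) \<Rightarrow> (nat \<Rightarrow> 'a) measure" where
  "ts_transcript \<epsilon> \<delta> C x sel l \<theta>0 v B T D =
     distr (ts_law \<epsilon> \<delta> C x sel l \<theta>0 v B D T) (PiM {1..T} C) fst"

end

theory Submission
  imports Defs
begin

text \<open>
  The two runs differ only in the batch that contains the changed round, and there only through
  the batch sum, which moves by at most 1 in norm and is released once, with Gaussian noise, when
  the batch ends. Before that release both states have the same law, and everything after it is
  post-processing by kernels that do not depend on the data, so the privacy loss is that of a single
  Gaussian mechanism. For the latter, with densities \<open>\<phi>\<^sub>w\<close> centred at \<open>w\<close>, the Chernoff-type bound
  \<open>\<phi>\<^sub>w \<le> exp \<epsilon> * \<phi>\<^sub>0 + \<phi>\<^sub>w * (\<phi>\<^sub>w / (exp \<epsilon> * \<phi>\<^sub>0)) powr s\<close> holds pointwise, and the last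
  summand is a multiple of the Gaussian density centred at \<open>(1 + s) w\<close>; the choice of the noise
  scale makes the multiple at most \<open>\<delta>\<close> for the optimal \<open>s\<close>.
\<close>

lemma borel_measurable_vecI:
  fixes f :: "'x \<Rightarrow> 'e::euclidean_space ^ 'd"
  assumes "\<And>i. (\<lambda>x. f x $ i) \<in> borel_measurable M"
  shows "f \<in> borel_measurable M"
proof (subst borel_measurable_euclidean_space, rule ballI)
  fix b :: "'e ^ 'd"
  assume "b \<in> Basis"
  then obtain i u where "b = axis i u"
    by (auto simp: Basis_vec_def)
  then show "(\<lambda>x. f x \<bullet> b) \<in> borel_measurable M"
    using assms by (simp add: inner_axis)
qed

lemma borel_measurable_vec_nth [measurable (raw)]:
  fixes f :: "'x \<Rightarrow> 'e::euclidean_space ^ 'd"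
  assumes "f \<in> borel_measurable M"
  shows "(\<lambda>x. f x $ i) \<in> borel_measurable M"
  using measurable_compose[OF assms borel_measurable_continuous_onI[of "\<lambda>v. v $ i"]]
  by (simp add: continuous_on_component)

lemma borel_measurable_matrix_vector_mult [measurable (raw)]:
  fixes A :: "'x \<Rightarrow> real ^ 'd ^ 'e"
  assumes [measurable]: "A \<in> borel_measurable M" "z \<in> borel_measurable M"
  shows "(\<lambda>x. A x *v z x) \<in> borel_measurable M"
  by (rule borel_measurable_vecI) (simp add: matrix_vector_mult_def)

lemma borel_measurable_det [measurable (raw)]:
  fixes A :: "'x \<Rightarrow> real ^ 'd ^ 'd"
  assumes [measurable]: "A \<in> borel_measurable M"
  shows "(\<lambda>x. det (A x)) \<in> borel_measurable M"
  unfolding det_def by measurable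

lemma matrix_inv_eq:
  fixes A :: "real ^ 'd ^ 'd"
  assumes "A ** B = mat 1"
  shows "matrix_inv A = B"
proof -
  have B: "A ** B = mat 1 \<and> B ** A = mat 1"
    using assms matrix_left_right_inverse by blast
  then have "A ** matrix_inv A = mat 1"
    unfolding matrix_inv_def by (rule someI2) simp
  with B show ?thesis
    by (metis matrix_mul_assoc matrix_mul_lid matrix_mul_rid)
qed

lemma matrix_mul_matrix_inv:
  fixes A :: "real ^ 'd ^ 'd"
  assumes "det A \<noteq> 0"
  shows "A ** matrix_inv A = mat 1"
  using assms matrix_inv_eq unfolding invertible_det_nz[symmetric] invertible_def by metis

lemma borel_measurable_matrix_inv_mult:
  fixes A :: "'x \<Rightarrow> real ^ 'd ^ 'd"
  assumes [measurable]: "A \<in> borel_measurable M" "b \<in> borel_measurable M"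
    and det: "\<And>x. x \<in> space M \<Longrightarrow> det (A x) \<noteq> 0"
  shows "(\<lambda>x. matrix_inv (A x) *v b x) \<in> borel_measurable M"
proof -
  have "matrix_inv (A x) *v b x = (\<chi> k. det (\<chi> i j. if j = k then b x $ i else A x $ i $ j) / det (A x))"
    if "x \<in> space M" for x
    by (subst cramer[OF det[OF that], symmetric])
      (simp add: matrix_vector_mul_assoc matrix_mul_matrix_inv det[OF that])
  moreover have "(\<lambda>x. \<chi> k. det (\<chi> i j. if j = k then b x $ i else A x $ i $ j) / det (A x))
      \<in> borel_measurable M"
  proof (rule borel_measurable_vecI)
    fix k
    have [measurable]: "(\<lambda>x. \<chi> i j. if j = k then b x $ i else A x $ i $ j) \<in> borel_measurable M"
      by (intro borel_measurable_vecI) simp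
    show "(\<lambda>x. (\<chi> k. det (\<chi> i j. if j = k then b x $ i else A x $ i $ j) / det (A x)) $ k)
        \<in> borel_measurable M"
      by simp
  qed
  ultimately show ?thesis
    by (simp cong: measurable_cong)
qed

lemma borel_measurable_clip [measurable]: "clip \<in> borel_measurable borel"
  unfolding clip_def by measurable

lemma borel_measurable_outer [measurable]: "outer \<in> borel_measurable borel"
  by (intro borel_measurable_vecI) (simp add: outer_def)

section \<open>Gaussian measures\<close>

lemma nn_integral_lborel_translate:
  fixes a :: "'a::euclidean_space"
  assumes [measurable]: "f \<in> borel_measurable borel"
  shows "(\<integral>\<^sup>+z. f (a + z) \<partial>lborel) = (\<integral>\<^sup>+z. f z \<partial>lborel)"
proof -
  have "(\<integral>\<^sup>+z. f z \<partial>lborel) = (\<integral>\<^sup>+z. f z \<partial>distr lborel borel ((+) a))"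
    by (simp add: lborel_distr_plus)
  then show ?thesis
    by (simp add: nn_integral_distr)
qed

text \<open>
  Translating by \<open>t *\<^sub>R e\<close> does not change the integral of \<open>f (z + (c \<bullet> z) *\<^sub>R e)\<close>, as \<open>c \<bullet> e = 0\<close>.
  Averaging over \<open>t \<in> {0..1}\<close> and substituting \<open>t - c \<bullet> z\<close> for \<open>t\<close> turns the shear into a translation.
\<close>

lemma nn_integral_lborel_shear:
  fixes e c :: "'a::euclidean_space"
  assumes [measurable]: "f \<in> borel_measurable borel" and ce: "c \<bullet> e = 0"
  shows "(\<integral>\<^sup>+z. f (z + (c \<bullet> z) *\<^sub>R e) \<partial>lborel) = (\<integral>\<^sup>+z. f z \<partial>lborel)"
proof -
  let ?w = "indicator {0..1} :: real \<Rightarrow> ennreal"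
  have w: "(\<integral>\<^sup>+t. ?w (a + t) \<partial>lborel) = 1" for a
    using nn_integral_lborel_translate[of ?w a] by simp
  have 1: "(\<integral>\<^sup>+z. f (z + (c \<bullet> z) *\<^sub>R e) \<partial>lborel)
      = (\<integral>\<^sup>+z. f (z + (t + c \<bullet> z) *\<^sub>R e) \<partial>lborel)" for t
    using nn_integral_lborel_translate[of "\<lambda>z. f (z + (c \<bullet> z) *\<^sub>R e)" "t *\<^sub>R e"]
    by (simp add: inner_add_right ce algebra_simps)
  have "(\<integral>\<^sup>+z. f (z + (c \<bullet> z) *\<^sub>R e) \<partial>lborel)
      = (\<integral>\<^sup>+t. ?w t * (\<integral>\<^sup>+z. f (z + (c \<bullet> z) *\<^sub>R e) \<partial>lborel) \<partial>lborel)"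
    using w[of 0] by (simp add: nn_integral_multc)
  also have "\<dots> = (\<integral>\<^sup>+t. \<integral>\<^sup>+z. ?w t * f (z + (t + c \<bullet> z) *\<^sub>R e) \<partial>lborel \<partial>lborel)"
    by (intro nn_integral_cong, subst nn_integral_cmult) (simp_all add: 1[symmetric])
  also have "\<dots> = (\<integral>\<^sup>+z. \<integral>\<^sup>+t. ?w t * f (z + (t + c \<bullet> z) *\<^sub>R e) \<partial>lborel \<partial>lborel)"
    by (rule lborel_pair.Fubini') measurable
  also have "\<dots> = (\<integral>\<^sup>+z. \<integral>\<^sup>+t. ?w (- (c \<bullet> z) + t) * f (z + t *\<^sub>R e) \<partial>lborel \<partial>lborel)"
  proof (rule nn_integral_cong)
    fix z :: 'a
    show "(\<integral>\<^sup>+t. ?w t * f (z + (t + c \<bullet> z) *\<^sub>R e) \<partial>lborel)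
        = (\<integral>\<^sup>+t. ?w (- (c \<bullet> z) + t) * f (z + t *\<^sub>R e) \<partial>lborel)"
      using nn_integral_lborel_translate[of "\<lambda>t. ?w t * f (z + (t + c \<bullet> z) *\<^sub>R e)" "- (c \<bullet> z)"]
      by simp
  qed
  also have "\<dots> = (\<integral>\<^sup>+t. \<integral>\<^sup>+z. ?w (- (c \<bullet> z) + t) * f (z + t *\<^sub>R e) \<partial>lborel \<partial>lborel)"
    by (rule lborel_pair.Fubini') measurable
  also have "\<dots> = (\<integral>\<^sup>+t. \<integral>\<^sup>+z. ?w (- (c \<bullet> z) + t) * f z \<partial>lborel \<partial>lborel)"
  proof (rule nn_integral_cong)
    fix t :: real
    show "(\<integral>\<^sup>+z. ?w (- (c \<bullet> z) + t) * f (z + t *\<^sub>R e) \<partial>lborel)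
        = (\<integral>\<^sup>+z. ?w (- (c \<bullet> z) + t) * f z \<partial>lborel)"
      using nn_integral_lborel_translate[of "\<lambda>z. ?w (- (c \<bullet> z) + t) * f z" "t *\<^sub>R e"]
      by (simp add: inner_add_right ce add.commute)
  qed
  also have "\<dots> = (\<integral>\<^sup>+z. \<integral>\<^sup>+t. ?w (- (c \<bullet> z) + t) * f z \<partial>lborel \<partial>lborel)"
    by (rule lborel_pair.Fubini') measurable
  also have "\<dots> = (\<integral>\<^sup>+z. f z \<partial>lborel)"
  proof (rule nn_integral_cong)
    fix z :: 'a
    have "(\<integral>\<^sup>+t. ?w (- (c \<bullet> z) + t) * f z \<partial>lborel) = (\<integral>\<^sup>+t. ?w (- (c \<bullet> z) + t) \<partial>lborel) * f z"
      by (rule nn_integral_multc) measurable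
    then show "(\<integral>\<^sup>+t. ?w (- (c \<bullet> z) + t) * f z \<partial>lborel) = f z"
      by (simp only: w mult_1)
  qed
  finally show ?thesis .
qed

definition pos_def :: "real ^ 'd ^ 'd \<Rightarrow> bool" where
  "pos_def A \<longleftrightarrow> transpose A = A \<and> (\<forall>z. z \<noteq> 0 \<longrightarrow> 0 < z \<bullet> (A *v z))"

lemma nn_integral_gaussian_real:
  fixes a :: real
  assumes a: "a > 0"
  shows "(\<integral>\<^sup>+y. ennreal (exp (- (a * y\<^sup>2) / 2)) \<partial>lborel) = ennreal (sqrt (2 * pi / a))"
proof -
  have "(\<integral>\<^sup>+y. ennreal (exp (- (a * y\<^sup>2) / 2)) \<partial>lborel)
      = (\<integral>\<^sup>+y. ennreal (sqrt (2 * pi / a)) * ennreal (normal_density 0 (1 / sqrt a) y) \<partial>lborel)"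
    using a by (intro nn_integral_cong)
      (simp add: normal_density_def ennreal_mult'[symmetric] power_divide field_simps)
  also have "\<dots> = ennreal (sqrt (2 * pi / a)) * ennreal (\<integral>y. normal_density 0 (1 / sqrt a) y \<partial>lborel)"
    using a by (subst nn_integral_cmult) (auto simp: nn_integral_eq_integral)
  finally show ?thesis
    using a by simp
qed

lemma matrix_entry: "A $ i $ j = axis i 1 \<bullet> (A *v axis j (1::real))"
  by (simp add: matrix_vector_mult_basis column_def inner_axis')

lemma det_rank_one_shear:
  fixes c :: "real ^ 'd"
  assumes "c $ k = 0"
  shows "det (\<chi> i j. (if i = j then 1 else 0) + (if i = k then c $ j else 0)) = 1"
proof -
  have "c \<in> vec.span {row j (mat 1 :: real ^ 'd ^ 'd) |j. j \<noteq> k}"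
  proof -
    have "c = (\<Sum>j\<in>UNIV - {k}. c $ j *s row j (mat 1 :: real ^ 'd ^ 'd))"
      using assms by (simp add: vec_eq_iff row_def mat_def sum.remove[of UNIV k] sum.delta if_distrib
          cong: if_cong)
    also have "\<dots> \<in> vec.span {row j (mat 1 :: real ^ 'd ^ 'd) |j. j \<noteq> k}"
      by (intro vec.span_sum vec.span_scale vec.span_base) auto
    finally show ?thesis .
  qed
  from det_row_span[OF this] have
    "det (\<chi> i. if i = k then row k (mat 1) + c else row i (mat 1 :: real ^ 'd ^ 'd)) = 1"
    by simp
  also have "(\<chi> i. if i = k then row k (mat 1) + c else row i (mat 1 :: real ^ 'd ^ 'd))
      = (\<chi> i j. (if i = j then 1 else 0) + (if i = k then c $ j else 0))"
    by (auto simp: vec_eq_iff row_def mat_def)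
  finally show ?thesis .
qed

lemma prod_Basis_vec:
  "(\<Prod>b\<in>(Basis :: (real ^ 'd) set). g b) = (\<Prod>i\<in>UNIV. g (axis i 1))"
proof -
  have "(Basis :: (real ^ 'd) set) = range (\<lambda>i. axis i 1)"
    by (auto simp: Basis_vec_def)
  moreover have "inj (\<lambda>i::'d. axis i (1::real))"
    by (simp add: inj_on_def axis_eq_axis)
  ultimately show ?thesis
    using prod.reindex[of "\<lambda>i::'d. axis i (1::real)" UNIV g] by (simp add: o_def)
qed

lemma sqrt_prod: "sqrt (\<Prod>i\<in>I. f i) = (\<Prod>i\<in>I. sqrt (f i))"
  by (induction I rule: infinite_finite_induct) (simp_all add: real_sqrt_mult)

lemma nn_integral_gaussian_diagonal:
  fixes A :: "real ^ 'd ^ 'd"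
  assumes pos: "\<And>i. A $ i $ i > 0" and diag: "\<And>i j. i \<noteq> j \<Longrightarrow> A $ i $ j = 0"
  shows "(\<integral>\<^sup>+z. ennreal (exp (- (z \<bullet> (A *v z)) / 2)) \<partial>lborel)
    = ennreal (sqrt ((2 * pi) ^ CARD('d) / det A))"
proof -
  define d where "d b = b \<bullet> (A *v b)" for b
  have d: "d (axis i 1) = A $ i $ i" for i
    by (simp add: d_def matrix_entry)
  let ?f = "\<lambda>b y. ennreal (exp (- (d b * y\<^sup>2) / 2))"
  have q: "z \<bullet> (A *v z) = (\<Sum>i\<in>UNIV. A $ i $ i * (z $ i)\<^sup>2)" for z
  proof -
    have "(A *v z) $ i = A $ i $ i * z $ i" for i
      using diag[of i] by (simp add: matrix_vector_mult_def sum.remove[of UNIV i])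
    then show ?thesis
      by (simp add: inner_vec_def power2_eq_square algebra_simps)
  qed
  have "ennreal (exp (- (z \<bullet> (A *v z)) / 2)) = (\<Prod>b\<in>Basis. ?f b (z \<bullet> b))" for z
    by (simp add: prod_Basis_vec prod_ennreal d inner_axis q
        exp_sum[symmetric] sum_negf sum_divide_distrib[symmetric])
  then have "(\<integral>\<^sup>+z. ennreal (exp (- (z \<bullet> (A *v z)) / 2)) \<partial>lborel)
      = (\<Prod>b\<in>Basis. (\<integral>\<^sup>+y. ?f b y \<partial>lborel))"
    by (simp only:) (rule nn_integral_lborel_prod, simp_all)
  also have "\<dots> = (\<Prod>i\<in>UNIV. ennreal (sqrt (2 * pi / A $ i $ i)))"
    using nn_integral_gaussian_real[OF pos] by (simp add: prod_Basis_vec d)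
  also have "\<dots> = ennreal (\<Prod>i\<in>UNIV. sqrt (2 * pi / A $ i $ i))"
    using pos by (intro prod_ennreal) (simp add: less_imp_le)
  also have "(\<Prod>i\<in>UNIV. sqrt (2 * pi / A $ i $ i)) = sqrt (\<Prod>i\<in>UNIV. 2 * pi / A $ i $ i)"
    by (rule sqrt_prod[symmetric])
  also have "\<dots> = sqrt ((2 * pi) ^ CARD('d) / det A)"
    by (simp add: det_diagonal diag prod_dividef)
  finally show ?thesis .
qed

lemma pos_def_diag: "pos_def A \<Longrightarrow> A $ i $ i > 0"
  unfolding pos_def_def matrix_entry[of A] by (simp add: axis_eq_0_iff)

lemma pos_def_sym: "pos_def A \<Longrightarrow> A $ i $ j = A $ j $ i"
  unfolding pos_def_def by (metis transpose_def vec_lambda_beta)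

text \<open>
  Gaussian elimination by congruences: completing the square in coordinate \<open>k\<close> is a shear, which
  preserves both \<open>lborel\<close> and the determinant. The library's linear change of variables requires a
  well-ordered index type, hence is not available for an arbitrary finite \<open>'d\<close>.
\<close>

lemma pos_def_gaussian_aux:
  fixes A :: "real ^ 'd ^ 'd"
  assumes "finite S" "pos_def A" "\<And>i j. i \<noteq> j \<Longrightarrow> A $ i $ j \<noteq> 0 \<Longrightarrow> i \<in> S \<and> j \<in> S"
  shows "det A > 0 \<and> (\<integral>\<^sup>+z. ennreal (exp (- (z \<bullet> (A *v z)) / 2)) \<partial>lborel)
    = ennreal (sqrt ((2 * pi) ^ CARD('d) / det A))"
  using assms
proof (induction S arbitrary: A rule: finite_induct)
  case empty
  then have "A $ i $ j = 0" if "i \<noteq> j" for i j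
    using that by blast
  with empty.prems(1) show ?case
    using nn_integral_gaussian_diagonal[of A] by (auto intro!: prod_pos simp: pos_def_diag det_diagonal)
next
  case (insert k S)
  note pd = \<open>pos_def A\<close>
  let ?a = "A $ k $ k"
  have a: "?a > 0"
    using pd by (rule pos_def_diag)
  define c :: "real ^ 'd" where "c = (\<chi> j. if j = k then 0 else - A $ k $ j / ?a)"
  define M :: "real ^ 'd ^ 'd"
    where "M = (\<chi> i j. (if i = j then 1 else 0) + (if i = k then c $ j else 0))"
  define A' where "A' = transpose M ** A ** M"
  have ck: "c $ k = 0"
    by (simp add: c_def)
  have M: "M *v z = z + (c \<bullet> z) *\<^sub>R axis k 1" for z
    by (auto simp: M_def vec_eq_iff matrix_vector_mult_def inner_vec_def axis_def
        distrib_right sum.distrib if_distrib[of "\<lambda>x. x * _"] sum.delta cong: if_cong)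
  have form: "y \<bullet> (A' *v z) = (M *v y) \<bullet> (A *v (M *v z))" for y z
    by (simp add: A'_def matrix_vector_mul_assoc[symmetric] inner_commute[of y] dot_lmul_matrix
        inner_commute[of "A *v _"])
  have "0 < z \<bullet> (A' *v z)" if "z \<noteq> 0" for z
  proof -
    have "M *v z \<noteq> 0"
    proof
      assume "M *v z = 0"
      then have z: "z = - (c \<bullet> z) *\<^sub>R axis k 1"
        by (simp add: M eq_neg_iff_add_eq_0)
      then have "c \<bullet> z = c \<bullet> (- (c \<bullet> z) *\<^sub>R axis k 1)"
        by (rule arg_cong)
      then have "c \<bullet> z = 0"
        by (simp add: inner_axis ck)
      with z that show False by simp
    qed
    then show ?thesis
      using pd by (simp add: form pos_def_def)
  qed
  moreover have "transpose A' = A'"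
    using pd by (simp add: A'_def matrix_transpose_mul pos_def_def matrix_mul_assoc)
  ultimately have pd': "pos_def A'"
    by (simp add: pos_def_def)
  have entry: "A' $ i $ j = A $ i $ j + c $ j * A $ i $ k + c $ i * (A $ k $ j + c $ j * ?a)" for i j
    by (simp add: matrix_entry form M matrix_vector_right_distrib inner_add_left
        inner_add_right inner_axis scaleR_matrix_vector_assoc[symmetric]
        matrix_vector_mult_scaleR algebra_simps)
  have "i \<in> S \<and> j \<in> S" if "i \<noteq> j" "A' $ i $ j \<noteq> 0" for i j
  proof -
    have row: "A $ k $ j + c $ j * ?a = 0" if "j \<noteq> k" for j
      using that a by (simp add: c_def)
    have "i \<noteq> k"
      using that row[of j] ck by (auto simp: entry)
    moreover have "j \<noteq> k"
      using that row[of i] ck pos_def_sym[OF pd, of i k] by (auto simp: entry)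
    ultimately have "A $ i $ j + c $ j * A $ i $ k \<noteq> 0"
      using that row[of j] by (simp add: entry)
    then have "A $ i $ j \<noteq> 0 \<or> A $ k $ j \<noteq> 0 \<and> A $ i $ k \<noteq> 0"
      using \<open>j \<noteq> k\<close> by (auto simp: c_def)
    then show ?thesis
      using insert.prems(2) \<open>i \<noteq> k\<close> \<open>j \<noteq> k\<close> that(1) by (metis insert_iff)
  qed
  note IH = insert.IH[OF pd' this]
  have "det A' = det A"
    by (simp add: A'_def det_mul M_def det_rank_one_shear[OF ck])
  moreover have "(\<integral>\<^sup>+z. ennreal (exp (- (z \<bullet> (A' *v z)) / 2)) \<partial>lborel)
      = (\<integral>\<^sup>+z. ennreal (exp (- (z \<bullet> (A *v z)) / 2)) \<partial>lborel)"
    unfolding form M by (rule nn_integral_lborel_shear) (simp_all add: inner_axis ck)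
  ultimately show ?case
    using IH by simp
qed

lemma pos_def_det_pos: "pos_def A \<Longrightarrow> det A > 0"
  using pos_def_gaussian_aux[of UNIV A] by simp

lemma nn_integral_gaussian:
  fixes A :: "real ^ 'd ^ 'd"
  assumes "pos_def A"
  shows "(\<integral>\<^sup>+z. ennreal (exp (- (z \<bullet> (A *v z)) / 2)) \<partial>lborel)
    = ennreal (sqrt ((2 * pi) ^ CARD('d) / det A))"
  using pos_def_gaussian_aux[of UNIV A] assms by simp

lemma pos_def_scaleR: "pos_def A \<Longrightarrow> c > 0 \<Longrightarrow> pos_def (c *\<^sub>R A)"
  by (simp add: pos_def_def transpose_scalar scaleR_matrix_vector_assoc[symmetric])

definition gauss_density :: "real ^ 'd ^ 'd \<Rightarrow> real ^ 'd \<Rightarrow> real ^ 'd \<Rightarrow> real" where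
  "gauss_density P \<mu> z =
    exp (- ((z - \<mu>) \<bullet> (P *v (z - \<mu>))) / 2) / sqrt ((2 * pi) ^ CARD('d) / det P)"

lemma borel_measurable_gauss_density [measurable (raw)]:
  assumes [measurable]: "P \<in> borel_measurable M" "\<mu> \<in> borel_measurable M" "z \<in> borel_measurable M"
  shows "(\<lambda>x. gauss_density (P x) (\<mu> x) (z x)) \<in> borel_measurable M"
  unfolding gauss_density_def by measurable

lemma nn_integral_gauss_density:
  fixes P :: "real ^ 'd ^ 'd"
  assumes "pos_def P"
  shows "(\<integral>\<^sup>+z. ennreal (gauss_density P \<mu> z) \<partial>lborel) = 1"
proof -
  let ?c = "sqrt ((2 * pi) ^ CARD('d) / det P)"
  have c: "?c > 0"
    using pos_def_det_pos[OF assms] by simp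
  have "(\<integral>\<^sup>+z. ennreal (gauss_density P \<mu> z) \<partial>lborel)
      = (\<integral>\<^sup>+z. ennreal (gauss_density P \<mu> (\<mu> + z)) \<partial>lborel)"
    by (rule nn_integral_lborel_translate[symmetric]) measurable
  also have "\<dots> = (\<integral>\<^sup>+z. ennreal (exp (- (z \<bullet> (P *v z)) / 2)) * ennreal (1 / ?c) \<partial>lborel)"
    using c by (intro nn_integral_cong)
      (simp only: gauss_density_def add_diff_cancel_left' ennreal_mult'[symmetric] exp_ge_zero
        times_divide_eq_right mult_1_right)
  also have "\<dots> = ennreal ?c * ennreal (1 / ?c)"
    by (simp only: nn_integral_gaussian[OF assms, symmetric]) (rule nn_integral_multc, measurable)
  also have "\<dots> = ennreal (?c * (1 / ?c))"
    using c by (intro ennreal_mult'[symmetric]) simp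
  also have "?c * (1 / ?c) = 1"
    using c by (metis less_numeral_extra(3) nonzero_mult_divide_mult_cancel_left
        times_divide_eq_right mult_1_right divide_self)
  finally show ?thesis by simp
qed

lemma mv_normal_eq_gauss_density:
  fixes \<Sigma> :: "real ^ 'd ^ 'd"
  assumes "\<Sigma> ** P = mat 1"
  shows "mv_normal \<mu> \<Sigma> = density lborel (\<lambda>z. ennreal (gauss_density P \<mu> z))"
proof -
  have "det \<Sigma> * det P = 1"
    using assms by (metis det_I det_mul)
  then have "det \<Sigma> = 1 / det P"
    by (metis nonzero_eq_divide_eq mult_zero_right zero_neq_one)
  then show ?thesis
    by (simp add: mv_normal_def gauss_density_def matrix_inv_eq[OF assms])
qed

lemma measurable_mv_normal:
  fixes \<Sigma> P :: "'x \<Rightarrow> real ^ 'd ^ 'd"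
  assumes [measurable]: "P \<in> borel_measurable M" "\<mu> \<in> borel_measurable M"
    and P: "\<And>x. x \<in> space M \<Longrightarrow> pos_def (P x)" "\<And>x. x \<in> space M \<Longrightarrow> \<Sigma> x ** P x = mat 1"
  shows "(\<lambda>x. mv_normal (\<mu> x) (\<Sigma> x)) \<in> M \<rightarrow>\<^sub>M prob_algebra borel"
proof -
  let ?k = "\<lambda>x. density lborel (\<lambda>z. ennreal (gauss_density (P x) (\<mu> x) z))"
  have prob: "prob_space (?k x)" if "x \<in> space M" for x
    using nn_integral_gauss_density[OF P(1)[OF that]]
    by (intro prob_spaceI) (simp add: emeasure_density)
  have "?k \<in> M \<rightarrow>\<^sub>M prob_algebra borel"
  proof (intro measurable_prob_algebraI measurable_subprob_algebra)
    fix X :: "(real ^ 'd) set"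
    assume [measurable]: "X \<in> sets borel"
    show "(\<lambda>x. emeasure (?k x) X) \<in> borel_measurable M"
      by (simp add: emeasure_density) measurable
  qed (simp_all add: prob prob_space_imp_subprob_space)
  then show ?thesis
    by (rule measurable_cong[THEN iffD2, rotated]) (simp add: mv_normal_eq_gauss_density[OF P(2)])
qed

lemma pos_def_mat:
  assumes "c > 0"
  shows "pos_def (mat c :: real ^ 'd ^ 'd)"
proof -
  have "mat c = c *\<^sub>R (mat 1 :: real ^ 'd ^ 'd)"
    by (simp add: vec_eq_iff mat_def)
  moreover have "pos_def (mat 1 :: real ^ 'd ^ 'd)"
    by (simp add: pos_def_def)
  ultimately show ?thesis
    using pos_def_scaleR[OF _ assms] by simp
qed

lemma mat_mult_vector: "mat c *v z = c *\<^sub>R (z :: real ^ 'd)"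
  by (simp add: vec_eq_iff matrix_vector_mult_def mat_def if_distrib[of "\<lambda>x. x * _"] sum.delta' cong: if_cong)

lemma outer_mult_vector: "outer v *v z = (v \<bullet> z) *\<^sub>R v"
  by (simp add: vec_eq_iff matrix_vector_mult_def outer_def inner_vec_def sum_distrib_right
      sum_distrib_left mult_ac)

lemma pos_def_design:
  assumes "l > 0"
  shows "pos_def (design l x t h)"
proof -
  have "transpose (design l x t h) = design l x t h"
    by (simp add: design_def vec_eq_iff transpose_def mat_def outer_def mult.commute)
  moreover have "0 < z \<bullet> (design l x t h *v z)" if "z \<noteq> 0" for z
  proof -
    have "(\<Sum>i\<in>S. outer (u i)) *v z = (\<Sum>i\<in>S. (u i \<bullet> z) *\<^sub>R u i)" for S :: "nat set" and u
      by (induction S rule: infinite_finite_induct)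
        (simp_all add: matrix_vector_mult_add_rdistrib outer_mult_vector)
    then have "z \<bullet> (design l x t h *v z) = l * (z \<bullet> z) + (\<Sum>i = 1..t. (clip (x i (h i)) \<bullet> z)\<^sup>2)"
      by (simp add: design_def matrix_vector_mult_add_rdistrib mat_mult_vector inner_add_right
          inner_sum_right power2_eq_square inner_commute)
    also have "\<dots> > 0"
      using assms that by (intro add_pos_nonneg sum_nonneg) simp_all
    finally show ?thesis .
  qed
  ultimately show ?thesis
    by (simp add: pos_def_def)
qed

section \<open>Approximate differential privacy\<close>

text \<open>Test functions instead of events, so that a kernel applied to both sides is again a test function.\<close>

definition dp_le :: "ennreal \<Rightarrow> ennreal \<Rightarrow> 'x measure \<Rightarrow> 'x measure \<Rightarrow> bool" where
  "dp_le c d P Q \<longleftrightarrow> (\<forall>f\<in>borel_measurable P. (\<forall>x\<in>space P. f x \<le> 1) \<longrightarrow>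
     (\<integral>\<^sup>+x. f x \<partial>P) \<le> c * (\<integral>\<^sup>+x. f x \<partial>Q) + d)"

lemma dp_leD:
  assumes "dp_le c d P Q" "f \<in> borel_measurable P" "\<And>x. x \<in> space P \<Longrightarrow> f x \<le> 1"
  shows "(\<integral>\<^sup>+x. f x \<partial>P) \<le> c * (\<integral>\<^sup>+x. f x \<partial>Q) + d"
  using assms by (auto simp: dp_le_def)

lemma dp_le_refl:
  assumes "c \<ge> 1"
  shows "dp_le c d P P"
  using mult_right_mono[OF assms] by (auto simp: dp_le_def intro: add_increasing2)

lemma prob_algebraD:
  "P \<in> space (prob_algebra S) \<Longrightarrow> prob_space P" "P \<in> space (prob_algebra S) \<Longrightarrow> sets P = sets S"
  "P \<in> space (prob_algebra S) \<Longrightarrow> space P = space S"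
  by (auto simp: space_prob_algebra dest: sets_eq_imp_space_eq)

lemma bind_in_prob_algebra:
  assumes "P \<in> space (prob_algebra S)" "K \<in> S \<rightarrow>\<^sub>M prob_algebra R"
  shows "P \<bind> K \<in> space (prob_algebra R)"
  using measurable_bind_prob_space[OF measurable_const[OF assms(1)] assms(2),
      THEN measurable_space, of undefined "count_space UNIV"] by simp

lemma nn_integral_bind_prob_algebra:
  assumes "P \<in> space (prob_algebra S)" "K \<in> S \<rightarrow>\<^sub>M prob_algebra R" "f \<in> borel_measurable R"
  shows "(\<integral>\<^sup>+y. f y \<partial>(P \<bind> K)) = (\<integral>\<^sup>+x. \<integral>\<^sup>+y. f y \<partial>K x \<partial>P)"
  using assms prob_algebraD(2)[OF assms(1)]
  by (intro nn_integral_bind[where B = R]) (auto dest!: measurable_prob_algebraD cong: measurable_cong_sets)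

lemma nn_integral_kernel_measurable:
  assumes "K \<in> S \<rightarrow>\<^sub>M prob_algebra R" "f \<in> borel_measurable R"
  shows "(\<lambda>x. \<integral>\<^sup>+y. f y \<partial>K x) \<in> borel_measurable S"
  using measurable_compose[OF measurable_prob_algebraD[OF assms(1)]
      nn_integral_measurable_subprob_algebra[OF assms(2)]] .

lemma dp_le_bind_same_kernel:
  assumes P: "P \<in> space (prob_algebra S)" and Q: "Q \<in> space (prob_algebra S)"
    and K: "K \<in> S \<rightarrow>\<^sub>M prob_algebra R" and le: "dp_le c d P Q"
  shows "dp_le c d (P \<bind> K) (Q \<bind> K)"
  unfolding dp_le_def
proof (intro ballI impI)
  note PK = bind_in_prob_algebra[OF P K]
  fix f :: "_ \<Rightarrow> ennreal" assume f: "f \<in> borel_measurable (P \<bind> K)" and f1: "\<forall>x\<in>space (P \<bind> K). f x \<le> 1"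
  have fR: "f \<in> borel_measurable R"
    using f prob_algebraD(2)[OF PK] by (simp cong: measurable_cong_sets)
  have "(\<integral>\<^sup>+y. f y \<partial>K x) \<le> 1" if x: "x \<in> space P" for x
  proof -
    have Kx: "K x \<in> space (prob_algebra R)"
      using measurable_space[OF K] x prob_algebraD(3)[OF P] by simp
    interpret prob_space "K x" by (rule prob_algebraD(1)[OF Kx])
    have "(\<integral>\<^sup>+y. f y \<partial>K x) \<le> (\<integral>\<^sup>+y. 1 \<partial>K x)"
      using f1 prob_algebraD(3)[OF Kx] prob_algebraD(3)[OF PK] by (intro nn_integral_mono) auto
    then show ?thesis by (simp add: emeasure_space_1)
  qed
  with le nn_integral_kernel_measurable[OF K fR] prob_algebraD(2)[OF P]
  show "(\<integral>\<^sup>+y. f y \<partial>(P \<bind> K)) \<le> c * (\<integral>\<^sup>+y. f y \<partial>(Q \<bind> K)) + d"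
    by (simp add: nn_integral_bind_prob_algebra[OF P K fR] nn_integral_bind_prob_algebra[OF Q K fR])
      (rule dp_leD, simp_all cong: measurable_cong_sets)
qed

lemma dp_le_bind_kernels:
  assumes P: "P \<in> space (prob_algebra S)" and K: "K \<in> S \<rightarrow>\<^sub>M prob_algebra R"
    and K': "K' \<in> S \<rightarrow>\<^sub>M prob_algebra R"
    and le: "\<And>x. x \<in> space S \<Longrightarrow> dp_le c d (K x) (K' x)"
  shows "dp_le c d (P \<bind> K) (P \<bind> K')"
  unfolding dp_le_def
proof (intro ballI impI)
  note PK = bind_in_prob_algebra[OF P K]
  interpret prob_space P by (rule prob_algebraD(1)[OF P])
  fix f :: "_ \<Rightarrow> ennreal" assume f: "f \<in> borel_measurable (P \<bind> K)" and f1: "\<forall>x\<in>space (P \<bind> K). f x \<le> 1"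
  have fR: "f \<in> borel_measurable R"
    using f prob_algebraD(2)[OF PK] by (simp cong: measurable_cong_sets)
  have "(\<integral>\<^sup>+x. \<integral>\<^sup>+y. f y \<partial>K x \<partial>P) \<le> (\<integral>\<^sup>+x. c * (\<integral>\<^sup>+y. f y \<partial>K' x) + d \<partial>P)"
  proof (rule nn_integral_mono)
    fix x assume "x \<in> space P"
    then have x: "x \<in> space S"
      using prob_algebraD(3)[OF P] by simp
    have Kx: "K x \<in> space (prob_algebra R)"
      by (rule measurable_space[OF K x])
    show "(\<integral>\<^sup>+y. f y \<partial>K x) \<le> c * (\<integral>\<^sup>+y. f y \<partial>K' x) + d"
      using f1 fR prob_algebraD(2,3)[OF Kx] prob_algebraD(3)[OF PK]
      by (intro dp_leD[OF le[OF x]]) (auto cong: measurable_cong_sets)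
  qed
  also have "\<dots> = c * (\<integral>\<^sup>+x. \<integral>\<^sup>+y. f y \<partial>K' x \<partial>P) + d"
    using nn_integral_kernel_measurable[OF K' fR] prob_algebraD(2)[OF P]
    by (simp add: nn_integral_add nn_integral_cmult emeasure_space_1 cong: measurable_cong_sets)
  finally show "(\<integral>\<^sup>+y. f y \<partial>(P \<bind> K)) \<le> c * (\<integral>\<^sup>+y. f y \<partial>(P \<bind> K')) + d"
    by (simp add: nn_integral_bind_prob_algebra[OF P K fR] nn_integral_bind_prob_algebra[OF P K' fR])
qed

lemma gauss_density_mat:
  fixes z :: "real ^ 'd"
  shows "gauss_density (mat p) \<mu> z
    = exp (- (p * (norm (z - \<mu>))\<^sup>2) / 2) / sqrt ((2 * pi) ^ CARD('d) / det (mat p :: real ^ 'd ^ 'd))"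
  by (simp add: gauss_density_def mat_mult_vector power2_norm_eq_inner)

lemma gauss_density_shift_le:
  fixes w z :: "real ^ 'd"
  assumes p: "p > 0" and w: "norm w \<le> 1" and s: "s \<ge> 0"
  shows "gauss_density (mat p) w z \<le> exp \<epsilon> * gauss_density (mat p) 0 z
    + exp (s * (1 + s) * p / 2 - s * \<epsilon>) * gauss_density (mat p) ((1 + s) *\<^sub>R w) z"
proof -
  define a b c where "a = - (p * (norm (z - w))\<^sup>2) / 2" and "b = - (p * (norm z)\<^sup>2) / 2"
    and "c = - (p * (norm (z - (1 + s) *\<^sub>R w))\<^sup>2) / 2"
  have q: "(norm (z - t *\<^sub>R w))\<^sup>2 = (norm z)\<^sup>2 - 2 * t * (z \<bullet> w) + t\<^sup>2 * (norm w)\<^sup>2" for t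
    by (simp add: power2_norm_eq_inner inner_diff_left inner_diff_right inner_commute[of w z]
        power2_eq_square[of t] algebra_simps)
  have q1: "(norm (z - w))\<^sup>2 = (norm z)\<^sup>2 - 2 * (z \<bullet> w) + (norm w)\<^sup>2"
    using q[of 1] by simp
  have "a + s * (a - b) = c + s * (1 + s) * p / 2 * (norm w)\<^sup>2"
    unfolding a_def b_def c_def q1 q by (simp add: field_simps power2_eq_square)
  also have "\<dots> \<le> c + s * (1 + s) * p / 2"
    using mult_left_mono[of "(norm w)\<^sup>2" 1 "s * (1 + s) * p / 2"] w s p
    by (simp add: power_le_one)
  finally have *: "a + s * (a - b - \<epsilon>) \<le> (s * (1 + s) * p / 2 - s * \<epsilon>) + c"
    by (simp add: algebra_simps)
  have "exp a \<le> exp (\<epsilon> + b) + exp (a + s * (a - b - \<epsilon>))"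
  proof (cases "a \<le> \<epsilon> + b")
    case True
    then show ?thesis
      by (simp add: add_increasing2)
  next
    case False
    then have "a \<le> a + s * (a - b - \<epsilon>)"
      using s by simp
    then show ?thesis
      by (simp add: add_increasing)
  qed
  also have "exp (a + s * (a - b - \<epsilon>)) \<le> exp (s * (1 + s) * p / 2 - s * \<epsilon>) * exp c"
    using * by (simp add: exp_add[symmetric])
  finally have "exp a \<le> exp \<epsilon> * exp b + exp (s * (1 + s) * p / 2 - s * \<epsilon>) * exp c"
    by (simp add: exp_add)
  moreover have "sqrt ((2 * pi) ^ CARD('d) / det (mat p :: real ^ 'd ^ 'd)) > 0"
    using pos_def_det_pos[OF pos_def_mat[OF p, where 'd = 'd]] by simp
  ultimately show ?thesis
    by (simp only: gauss_density_mat a_def[symmetric] b_def[symmetric] c_def[symmetric] diff_zero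
        times_divide_eq_right add_divide_distrib[symmetric] divide_right_mono less_imp_le)
qed

text \<open>With \<open>m\<^sup>2 = ln (1 / \<delta>)\<close> and \<open>r\<^sup>2 = \<rho>\<close> one has \<open>\<epsilon> = r\<^sup>2 + 2 r m\<close>; the optimal
  Chernoff exponent is \<open>m / r\<close>.\<close>

lemma noise_sd_chernoff:
  assumes "\<epsilon> > 0" "0 < \<delta>" "\<delta> < 1"
  obtains s p where "s \<ge> 0" "p > 0" "(noise_sd \<epsilon> \<delta>)\<^sup>2 * p = 1"
    "exp (s * (1 + s) * p / 2 - s * \<epsilon>) = \<delta>"
proof -
  define L where "L = ln (1 / \<delta>)"
  define m where "m = sqrt L"
  define r where "r = sqrt (\<epsilon> + L) - m"
  have L: "L > 0"
    using assms by (simp add: L_def ln_gt_zero_iff)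
  have m: "m\<^sup>2 = L" "m \<ge> 0"
    using L by (simp_all add: m_def)
  have r: "r > 0"
    using assms by (simp add: r_def m_def)
  have "(r + m)\<^sup>2 = \<epsilon> + L"
    using L assms by (simp add: r_def)
  then have eps: "\<epsilon> = r\<^sup>2 + 2 * r * m"
    using m by (simp add: power2_sum)
  have rho: "zcdp_rho \<epsilon> \<delta> = r\<^sup>2"
    by (simp add: zcdp_rho_def r_def m_def L_def)
  have "m / r * (1 + m / r) * (2 * r\<^sup>2) / 2 - m / r * \<epsilon> = - L"
    using r unfolding eps m(1)[symmetric] by (simp add: field_simps power2_eq_square)
  then have "exp (m / r * (1 + m / r) * (2 * r\<^sup>2) / 2 - m / r * \<epsilon>) = \<delta>"
    using assms by (simp add: L_def ln_div)
  moreover have "(noise_sd \<epsilon> \<delta>)\<^sup>2 * (2 * r\<^sup>2) = 1"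
    using r by (simp add: noise_sd_def rho power_divide)
  ultimately show ?thesis
    using that[of "m / r" "2 * r\<^sup>2"] m r by simp
qed

lemma mat_mult_mat: "mat a ** mat b = (mat (a * b) :: real ^ 'd ^ 'd)"
  by (simp add: vec_eq_iff matrix_matrix_mult_def mat_def if_distrib[of "\<lambda>x. x * _"] sum.delta' cong: if_cong)

lemma measurable_noise:
  assumes "\<epsilon> > 0" "0 < \<delta>" "\<delta> < 1"
  shows "(\<lambda>x. mv_normal 0 (mat ((noise_sd \<epsilon> \<delta>)\<^sup>2) :: real ^ 'd ^ 'd)) \<in> M \<rightarrow>\<^sub>M prob_algebra borel"
proof -
  obtain p where p: "p > 0" "(noise_sd \<epsilon> \<delta>)\<^sup>2 * p = 1"
    using noise_sd_chernoff[OF assms] by metis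
  show ?thesis
    by (rule measurable_mv_normal[where P = "\<lambda>_. mat p"])
      (simp_all add: p pos_def_mat mat_mult_mat)
qed

lemma gaussian_mechanism:
  fixes w :: "real ^ 'd" and g :: "real ^ 'd \<Rightarrow> ennreal"
  assumes params: "\<epsilon> > 0" "0 < \<delta>" "\<delta> < 1" and w: "norm w \<le> 1"
    and g [measurable]: "g \<in> borel_measurable borel" and g1: "\<And>z. g z \<le> 1"
  shows "(\<integral>\<^sup>+\<eta>. g (w + \<eta>) \<partial>mv_normal 0 (mat ((noise_sd \<epsilon> \<delta>)\<^sup>2)))
    \<le> ennreal (exp \<epsilon>) * (\<integral>\<^sup>+\<eta>. g \<eta> \<partial>mv_normal 0 (mat ((noise_sd \<epsilon> \<delta>)\<^sup>2))) + ennreal \<delta>"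
proof -
  obtain s p where s: "s \<ge> 0" and p: "p > 0" "(noise_sd \<epsilon> \<delta>)\<^sup>2 * p = 1"
    and \<delta>: "exp (s * (1 + s) * p / 2 - s * \<epsilon>) = \<delta>"
    using noise_sd_chernoff[OF params] by metis
  let ?\<phi> = "\<lambda>\<mu> z. gauss_density (mat p :: real ^ 'd ^ 'd) \<mu> z"
  have N: "mv_normal 0 (mat ((noise_sd \<epsilon> \<delta>)\<^sup>2)) = density lborel (\<lambda>z. ennreal (?\<phi> 0 z))"
    by (rule mv_normal_eq_gauss_density) (simp add: p mat_mult_mat)
  have pos: "?\<phi> \<mu> z \<ge> 0" for \<mu> z
    using pos_def_det_pos[OF pos_def_mat[OF p(1), where 'd = 'd]] unfolding gauss_density_def
    by (intro divide_nonneg_nonneg real_sqrt_ge_zero) (simp_all add: less_imp_le)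
  have le: "ennreal (?\<phi> w z) * g z
      \<le> ennreal (exp \<epsilon>) * (ennreal (?\<phi> 0 z) * g z) + ennreal \<delta> * ennreal (?\<phi> ((1 + s) *\<^sub>R w) z)" for z
  proof -
    have "ennreal (?\<phi> w z) \<le> ennreal (exp \<epsilon> * ?\<phi> 0 z + \<delta> * ?\<phi> ((1 + s) *\<^sub>R w) z)"
      using gauss_density_shift_le[OF p(1) w s, of z \<epsilon>] unfolding \<delta> by (rule ennreal_leI)
    also have "\<dots> = ennreal (exp \<epsilon>) * ennreal (?\<phi> 0 z) + ennreal \<delta> * ennreal (?\<phi> ((1 + s) *\<^sub>R w) z)"
      using pos params by (simp add: ennreal_plus ennreal_mult)
    finally have "ennreal (?\<phi> w z) * g z
        \<le> (ennreal (exp \<epsilon>) * ennreal (?\<phi> 0 z) + ennreal \<delta> * ennreal (?\<phi> ((1 + s) *\<^sub>R w) z)) * g z"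
      by (rule mult_right_mono) simp
    also have "\<dots> \<le> ennreal (exp \<epsilon>) * (ennreal (?\<phi> 0 z) * g z)
        + ennreal \<delta> * ennreal (?\<phi> ((1 + s) *\<^sub>R w) z) * 1"
      unfolding distrib_right mult.assoc by (intro add_left_mono mult_left_mono g1) simp_all
    finally show ?thesis by simp
  qed
  have "(\<integral>\<^sup>+\<eta>. g (w + \<eta>) \<partial>mv_normal 0 (mat ((noise_sd \<epsilon> \<delta>)\<^sup>2)))
      = (\<integral>\<^sup>+\<eta>. ennreal (?\<phi> w (w + \<eta>)) * g (w + \<eta>) \<partial>lborel)"
    unfolding N by (simp add: nn_integral_density gauss_density_mat)
  also have "\<dots> = (\<integral>\<^sup>+z. ennreal (?\<phi> w z) * g z \<partial>lborel)"
    by (rule nn_integral_lborel_translate) measurable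
  also have "\<dots> \<le> (\<integral>\<^sup>+z. ennreal (exp \<epsilon>) * (ennreal (?\<phi> 0 z) * g z)
      + ennreal \<delta> * ennreal (?\<phi> ((1 + s) *\<^sub>R w) z) \<partial>lborel)"
    by (intro nn_integral_mono le)
  also have "\<dots> = ennreal (exp \<epsilon>) * (\<integral>\<^sup>+z. ennreal (?\<phi> 0 z) * g z \<partial>lborel) + ennreal \<delta>"
    by (simp add: nn_integral_add nn_integral_cmult nn_integral_gauss_density pos_def_mat p)
  finally show ?thesis
    unfolding N by (simp add: nn_integral_density)
qed

section \<open>The laws of the algorithm\<close>

definition ts_update ::
  "real \<Rightarrow> real \<Rightarrow> (nat \<Rightarrow> 'a measure) \<Rightarrow> (nat \<Rightarrow> 'a \<Rightarrow> real ^ 'd) \<Rightarrow> (nat \<Rightarrow> nat) \<Rightarrow>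
   (nat \<Rightarrow> 'u \<times> real) \<Rightarrow> nat \<Rightarrow> (nat \<Rightarrow> 'a) \<times> (real ^ 'd) \<Rightarrow> ((nat \<Rightarrow> 'a) \<times> (real ^ 'd)) measure" where
  "ts_update \<epsilon> \<delta> C x B D t = (\<lambda>(h, b).
     if t = batch_end B (batch_of B t)
     then mv_normal 0 (mat ((noise_sd \<epsilon> \<delta>)\<^sup>2)) \<bind>
       (\<lambda>\<eta>. return (state_space C t) (h, b + batch_sum B x D (batch_of B t) h + \<eta>))
     else return (state_space C t) (h, b))"

lemma ts_round_eq:
  "ts_round \<epsilon> \<delta> C x sel l v B D t = (\<lambda>(h, b).
     mv_normal (matrix_inv (design l x (t - 1) h) *v b)
       ((v (batch_of B t))\<^sup>2 *\<^sub>R matrix_inv (design l x (t - 1) h)) \<bind>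
     (\<lambda>\<theta>. sel t (h, \<theta>) \<bind> (\<lambda>a. ts_update \<epsilon> \<delta> C x B D t (h(t := a), b))))"
  by (simp add: ts_round_def ts_update_def Let_def)

lemma norm_clip_le: "norm (clip v) \<le> 1"
  by (simp add: clip_def field_simps)

lemma norm_batch_sum_diff_le:
  assumes "\<And>i. i \<in> {batch_end B (k - 1)<..batch_end B k} \<Longrightarrow> i \<noteq> i0 \<Longrightarrow> D i = D' i"
    and "\<And>i. i \<in> {batch_end B (k - 1)<..batch_end B k} \<Longrightarrow> snd (D i) \<in> {0..1} \<and> snd (D' i) \<in> {0..1}"
  shows "norm (batch_sum B x D k h - batch_sum B x D' k h) \<le> 1"
proof -
  let ?I = "{batch_end B (k - 1)<..batch_end B k}"
  have "batch_sum B x D k h - batch_sum B x D' k h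
      = (\<Sum>i\<in>?I. (snd (D i) - snd (D' i)) *\<^sub>R clip (x i (h i)))"
    by (simp add: batch_sum_def sum_subtractf scaleR_diff_left)
  also have "\<dots> = (\<Sum>i\<in>?I. if i = i0 then (snd (D i) - snd (D' i)) *\<^sub>R clip (x i (h i)) else 0)"
    using assms(1) by (intro sum.cong) auto
  also have "\<dots> = (if i0 \<in> ?I then (snd (D i0) - snd (D' i0)) *\<^sub>R clip (x i0 (h i0)) else 0)"
    by simp
  also have "norm \<dots> \<le> 1"
  proof (cases "i0 \<in> ?I")
    case True
    have "\<bar>snd (D i0) - snd (D' i0)\<bar> \<le> 1"
      using assms(2)[OF True] by auto
    then have "\<bar>snd (D i0) - snd (D' i0)\<bar> * norm (clip (x i0 (h i0))) \<le> 1"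
      using norm_clip_le by (intro mult_le_one) simp_all
    then show ?thesis
      using True by simp
  qed auto
  finally show ?thesis .
qed

lemma batch_end_mono: "i \<le> j \<Longrightarrow> batch_end B i \<le> batch_end B j"
  unfolding batch_end_def by (intro sum_mono2) auto

locale ts_instance =
  fixes \<epsilon> \<delta> l :: real and C :: "nat \<Rightarrow> 'a measure" and x :: "nat \<Rightarrow> 'a \<Rightarrow> real ^ 'd"
    and sel :: "nat \<Rightarrow> (nat \<Rightarrow> 'a) \<times> (real ^ 'd) \<Rightarrow> 'a measure" and \<theta>0 :: "real ^ 'd"
    and v :: "nat \<Rightarrow> real" and B :: "nat \<Rightarrow> nat" and T :: nat
  assumes params: "\<epsilon> > 0" "0 < \<delta>" "\<delta> < 1" and l: "l > 0" and v: "\<And>k. v k > 0"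
    and x: "\<And>t. t \<in> {1..T} \<Longrightarrow> x t \<in> borel_measurable (C t)"
    and sel: "\<And>t. t \<in> {1..T} \<Longrightarrow> sel t \<in> measurable (PiM {1..<t} C \<Otimes>\<^sub>M borel) (prob_algebra (C t))"
begin

abbreviation S :: "nat \<Rightarrow> ((nat \<Rightarrow> 'a) \<times> (real ^ 'd)) measure" where
  "S \<equiv> state_space C"

abbreviation update_law :: "(nat \<Rightarrow> 'u \<times> real) \<Rightarrow> nat \<Rightarrow> (nat \<Rightarrow> 'a) \<times> (real ^ 'd) \<Rightarrow> _" where
  "update_law \<equiv> ts_update \<epsilon> \<delta> C x B"

abbreviation round_law :: "(nat \<Rightarrow> 'u \<times> real) \<Rightarrow> nat \<Rightarrow> (nat \<Rightarrow> 'a) \<times> (real ^ 'd) \<Rightarrow> _" where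
  "round_law \<equiv> ts_round \<epsilon> \<delta> C x sel l v B"

abbreviation state_law :: "(nat \<Rightarrow> 'u \<times> real) \<Rightarrow> nat \<Rightarrow> _" where
  "state_law \<equiv> ts_law \<epsilon> \<delta> C x sel l \<theta>0 v B"

lemma clipped_feature_measurable:
  assumes "i \<in> {1..t}" "t \<le> T"
  shows "(\<lambda>h. clip (x i (h i))) \<in> borel_measurable (PiM {1..t} C)"
proof -
  have [measurable]: "x i \<in> borel_measurable (C i)"
    using x assms by simp
  have [measurable]: "(\<lambda>h. h i) \<in> PiM {1..t} C \<rightarrow>\<^sub>M C i"
    using assms by (intro measurable_component_singleton) simp
  show ?thesis by measurable
qed

lemma update_measurable:
  assumes t: "t \<in> {1..T}"
  shows "update_law D t \<in> S t \<rightarrow>\<^sub>M prob_algebra (S t)"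
proof (cases "t = batch_end B (batch_of B t)")
  case True
  let ?k = "batch_of B t"
  have [measurable]: "(\<lambda>h. batch_sum B x D ?k h) \<in> borel_measurable (PiM {1..t} C)"
    unfolding batch_sum_def using True[symmetric] t
    by (intro borel_measurable_sum borel_measurable_scaleR borel_measurable_const
        clipped_feature_measurable) auto
  have "(\<lambda>s. mv_normal 0 (mat ((noise_sd \<epsilon> \<delta>)\<^sup>2)) \<bind>
      (\<lambda>\<eta>. return (S t) (fst s, snd s + batch_sum B x D ?k (fst s) + \<eta>))) \<in> S t \<rightarrow>\<^sub>M prob_algebra (S t)"
    unfolding state_space_def
    by (intro measurable_bind_prob_space2[OF measurable_noise[OF params]]) measurable
  then show ?thesis
    using True by (simp add: ts_update_def case_prod_beta')
next
  case False
  then show ?thesis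
    by (simp add: ts_update_def case_prod_beta')
qed

lemma selection_measurable:
  assumes t: "t \<in> {1..T}"
  shows "(\<lambda>((h, b), \<theta>). sel t (h, \<theta>)) \<in> S (t - 1) \<Otimes>\<^sub>M borel \<rightarrow>\<^sub>M prob_algebra (C t)"
proof -
  have "{1..t - 1} = {1..<t}"
    using t by auto
  with sel[OF t] have [measurable]: "sel t \<in> PiM {1..t - 1} C \<Otimes>\<^sub>M borel \<rightarrow>\<^sub>M prob_algebra (C t)"
    by simp
  have "(\<lambda>s. sel t (fst (fst s), snd s)) \<in> S (t - 1) \<Otimes>\<^sub>M borel \<rightarrow>\<^sub>M prob_algebra (C t)"
    unfolding state_space_def by measurable
  then show ?thesis
    by (simp add: case_prod_beta')
qed

lemma extend_measurable:
  assumes t: "t \<in> {1..T}"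
  shows "(\<lambda>((h, b), a). (h(t := a), b)) \<in> S (t - 1) \<Otimes>\<^sub>M C t \<rightarrow>\<^sub>M S t"
proof -
  have "{1..t} = {1..t - 1} \<union> {t}"
    using t by auto
  then have [measurable]: "(\<lambda>s. (fst (fst s))(t := snd s)) \<in> S (t - 1) \<Otimes>\<^sub>M C t \<rightarrow>\<^sub>M PiM {1..t} C"
    unfolding state_space_def by (rule measurable_fun_upd) measurable
  have [measurable]: "(\<lambda>s. snd (fst s)) \<in> S (t - 1) \<Otimes>\<^sub>M C t \<rightarrow>\<^sub>M borel"
    unfolding state_space_def by measurable
  show ?thesis
    unfolding state_space_def[of C t] case_prod_beta' by measurable
qed

lemma posterior_measurable:
  assumes t: "t \<in> {1..T}"
  shows "(\<lambda>(h, b). mv_normal (matrix_inv (design l x (t - 1) h) *v b)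
      ((v (batch_of B t))\<^sup>2 *\<^sub>R matrix_inv (design l x (t - 1) h))) \<in> S (t - 1) \<rightarrow>\<^sub>M prob_algebra borel"
proof -
  let ?A = "\<lambda>s :: (nat \<Rightarrow> 'a) \<times> (real ^ 'd). design l x (t - 1) (fst s)"
  let ?c = "(v (batch_of B t))\<^sup>2"
  have c: "?c > 0"
    using v[of "batch_of B t"] by simp
  have pd: "pos_def (?A s)" for s
    by (rule pos_def_design[OF l])
  then have det: "det (?A s) \<noteq> 0" for s
    using pos_def_det_pos by (metis less_irrefl)
  have "(\<lambda>h. design l x (t - 1) h) \<in> borel_measurable (PiM {1..t - 1} C)"
    unfolding design_def using t
    by (intro borel_measurable_add borel_measurable_const borel_measurable_sum
        measurable_compose[OF clipped_feature_measurable borel_measurable_outer]) auto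
  then have [measurable]: "?A \<in> borel_measurable (S (t - 1))"
    unfolding state_space_def by measurable
  have [measurable]: "snd \<in> S (t - 1) \<rightarrow>\<^sub>M borel"
    unfolding state_space_def by measurable
  have [measurable]: "(\<lambda>s. matrix_inv (?A s) *v snd s) \<in> borel_measurable (S (t - 1))"
    by (intro borel_measurable_matrix_inv_mult det) measurable
  have "(\<lambda>s. mv_normal (matrix_inv (?A s) *v snd s) (?c *\<^sub>R matrix_inv (?A s)))
      \<in> S (t - 1) \<rightarrow>\<^sub>M prob_algebra borel"
  proof (rule measurable_mv_normal[where P = "\<lambda>s. (1 / ?c) *\<^sub>R ?A s"])
    show "pos_def ((1 / ?c) *\<^sub>R ?A s)" for s
      using c by (intro pos_def_scaleR pd) simp
    show "?c *\<^sub>R matrix_inv (?A s) ** ((1 / ?c) *\<^sub>R ?A s) = mat 1" for s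
      using matrix_mul_matrix_inv[OF det[of s]] c
      by (simp add: matrix_scalar_ac scalar_matrix_assoc matrix_left_right_inverse)
  qed measurable
  then show ?thesis
    by (simp add: case_prod_beta')
qed

lemma selection_update_measurable:
  assumes t: "t \<in> {1..T}"
  shows "(\<lambda>((h, b), \<theta>). sel t (h, \<theta>) \<bind> (\<lambda>a. update_law D t (h(t := a), b)))
    \<in> S (t - 1) \<Otimes>\<^sub>M borel \<rightarrow>\<^sub>M prob_algebra (S t)"
proof -
  have "(\<lambda>s. (fst (fst s), snd s)) \<in> (S (t - 1) \<Otimes>\<^sub>M borel) \<Otimes>\<^sub>M C t \<rightarrow>\<^sub>M S (t - 1) \<Otimes>\<^sub>M C t"
    by measurable
  from measurable_compose[OF this measurable_compose[OF extend_measurable[OF t] update_measurable[OF t, of D]]]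
  show ?thesis
    using measurable_bind_prob_space2[OF selection_measurable[OF t],
        of "\<lambda>s a. update_law D t ((fst (fst s))(t := a), snd (fst s))" "S t"]
    by (simp add: case_prod_beta')
qed

lemma round_measurable:
  assumes t: "t \<in> {1..T}"
  shows "round_law D t \<in> S (t - 1) \<rightarrow>\<^sub>M prob_algebra (S t)"
  using measurable_bind_prob_space2[OF posterior_measurable[OF t],
      of "\<lambda>s \<theta>. sel t (fst s, \<theta>) \<bind> (\<lambda>a. update_law D t ((fst s)(t := a), snd s))"]
    selection_update_measurable[OF t, of D]
  by (simp add: ts_round_eq case_prod_beta')

lemma state_law_in_prob_algebra:
  "t \<le> T \<Longrightarrow> state_law D t \<in> space (prob_algebra (S t))"
proof (induction t)
  case 0
  have "((\<lambda>_. undefined), l *\<^sub>R \<theta>0) \<in> space (S 0)"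
    by (simp add: state_space_def space_pair_measure space_PiM)
  then show ?case
    by (simp add: space_prob_algebra prob_space_return)
next
  case (Suc t)
  then show ?case
    using bind_in_prob_algebra[OF Suc.IH, of "round_law D (Suc t)"] round_measurable[of "Suc t" D]
    by simp
qed

lemma dp_le_round:
  assumes t: "t \<in> {1..T}" and s: "s \<in> space (S (t - 1))"
    and le: "\<And>s. s \<in> space (S t) \<Longrightarrow> dp_le c d (update_law D t s) (update_law D' t s)"
  shows "dp_le c d (round_law D t s) (round_law D' t s)"
proof -
  obtain h b where hb: "s = (h, b)"
    by (cases s)
  have ext: "(\<lambda>a. (h(t := a), b)) \<in> C t \<rightarrow>\<^sub>M S t"
    using measurable_compose[OF measurable_Pair1'[OF s] extend_measurable[OF t]] by (simp add: hb)
  have sel_s: "sel t (h, \<theta>) \<in> space (prob_algebra (C t))" for \<theta>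
    using measurable_space[OF selection_measurable[OF t], of "(s, \<theta>)"] s
    by (simp add: hb space_pair_measure)
  have kernel: "(\<lambda>\<theta>. sel t (h, \<theta>) \<bind> (\<lambda>a. update_law D t (h(t := a), b))) \<in> borel \<rightarrow>\<^sub>M prob_algebra (S t)" for D
    using measurable_compose[OF measurable_Pair1'[OF s] selection_update_measurable[OF t, of D]]
    by (simp add: hb)
  have "dp_le c d (sel t (h, \<theta>) \<bind> (\<lambda>a. update_law D t (h(t := a), b)))
      (sel t (h, \<theta>) \<bind> (\<lambda>a. update_law D' t (h(t := a), b)))" for \<theta>
    by (rule dp_le_bind_kernels[OF sel_s measurable_compose[OF ext update_measurable[OF t]]
          measurable_compose[OF ext update_measurable[OF t]] le]) (rule measurable_space[OF ext])
  moreover have "mv_normal (matrix_inv (design l x (t - 1) h) *v b)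
      ((v (batch_of B t))\<^sup>2 *\<^sub>R matrix_inv (design l x (t - 1) h)) \<in> space (prob_algebra borel)"
    using measurable_space[OF posterior_measurable[OF t] s] by (simp add: hb)
  ultimately show ?thesis
    unfolding hb ts_round_eq case_prod_conv by (intro dp_le_bind_kernels[OF _ kernel kernel])
qed

lemma dp_le_update:
  assumes t: "t \<in> {1..T}" and s: "s \<in> space (S t)"
    and diff: "\<And>h. t = batch_end B (batch_of B t) \<Longrightarrow>
      norm (batch_sum B x D (batch_of B t) h - batch_sum B x D' (batch_of B t) h) \<le> 1"
  shows "dp_le (ennreal (exp \<epsilon>)) (ennreal \<delta>) (update_law D t s) (update_law D' t s)"
proof (cases "t = batch_end B (batch_of B t)")
  case True
  obtain h b where hb: "s = (h, b)"
    by (cases s)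
  let ?N = "mv_normal 0 (mat ((noise_sd \<epsilon> \<delta>)\<^sup>2)) :: (real ^ 'd) measure"
  let ?m = "\<lambda>D. b + batch_sum B x D (batch_of B t) h"
  let ?K = "\<lambda>D \<eta>. return (S t) (h, ?m D + \<eta>)"
  have N: "?N \<in> space (prob_algebra borel)"
    using measurable_space[OF measurable_noise[OF params], of undefined "count_space UNIV"] by simp
  have h: "h \<in> space (PiM {1..t} C)"
    using s by (simp add: hb state_space_def space_pair_measure)
  have pair: "(\<lambda>\<eta>. (h, m + \<eta>)) \<in> borel \<rightarrow>\<^sub>M S t" for m :: "real ^ 'd"
    unfolding state_space_def using h by measurable
  have K: "?K D \<in> borel \<rightarrow>\<^sub>M prob_algebra (S t)" for D :: "nat \<Rightarrow> 'u \<times> real"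
    by (rule measurable_compose[OF pair measurable_return_prob_space])
  have upd: "update_law D t s = ?N \<bind> ?K D" for D :: "nat \<Rightarrow> 'u \<times> real"
    using True by (simp add: ts_update_def hb)
  show ?thesis
    unfolding dp_le_def
  proof (intro ballI impI)
    fix f :: "_ \<Rightarrow> ennreal"
    note PK = bind_in_prob_algebra[OF N K]
    assume "f \<in> borel_measurable (update_law D t s)" and "\<forall>y\<in>space (update_law D t s). f y \<le> 1"
    then have f: "f \<in> borel_measurable (S t)" and f1: "\<And>y. y \<in> space (S t) \<Longrightarrow> f y \<le> 1"
      using prob_algebraD(2,3)[OF PK[of D]] by (simp_all add: upd cong: measurable_cong_sets)
    have int: "(\<integral>\<^sup>+y. f y \<partial>update_law D t s) = (\<integral>\<^sup>+\<eta>. f (h, ?m D + \<eta>) \<partial>?N)"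
      for D :: "nat \<Rightarrow> 'u \<times> real"
      unfolding upd nn_integral_bind_prob_algebra[OF N K f]
      using measurable_space[OF pair] f by (simp add: nn_integral_return)
    have "(\<lambda>\<eta>. f (h, ?m D' + \<eta>)) \<in> borel_measurable borel"
      by (rule measurable_compose[OF pair f])
    from gaussian_mechanism[OF params diff[of h, OF True] this]
    have "(\<integral>\<^sup>+\<eta>. f (h, ?m D' + ((?m D - ?m D') + \<eta>)) \<partial>?N)
        \<le> ennreal (exp \<epsilon>) * (\<integral>\<^sup>+\<eta>. f (h, ?m D' + \<eta>) \<partial>?N) + ennreal \<delta>"
      using measurable_space[OF pair] f1 by simp
    then show "(\<integral>\<^sup>+y. f y \<partial>update_law D t s)
        \<le> ennreal (exp \<epsilon>) * (\<integral>\<^sup>+y. f y \<partial>update_law D' t s) + ennreal \<delta>"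
      by (simp add: int algebra_simps)
  qed
next
  case False
  then show ?thesis
    using params by (simp add: ts_update_def case_prod_beta' dp_le_refl)
qed

lemma dp_le_state_law:
  assumes adj: "adjacent T D D'"
    and r: "\<And>t. t \<in> {1..T} \<Longrightarrow> snd (D t) \<in> {0..1} \<and> snd (D' t) \<in> {0..1}"
  shows "dp_le (ennreal (exp \<epsilon>)) (ennreal \<delta>) (state_law D T) (state_law D' T)"
proof -
  obtain t0 where t0: "t0 \<in> {1..T}" "\<And>i. i \<in> {1..T} \<Longrightarrow> i \<noteq> t0 \<Longrightarrow> D i = D' i"
    using adj by (auto simp: adjacent_def)
  define active where
    "active t \<longleftrightarrow> t = batch_end B (batch_of B t) \<and> batch_end B (batch_of B t - 1) < t0 \<and> t0 \<le> t" for t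
  have active_unique: "\<not> active t" if "active s" "s < t" for s t
  proof
    assume "active t"
    have "batch_of B s < batch_of B t"
      using that \<open>active t\<close> batch_end_mono[of "batch_of B t" "batch_of B s" B]
      by (force simp: active_def not_less[symmetric])
    then have "batch_end B (batch_of B s) \<le> batch_end B (batch_of B t - 1)"
      by (intro batch_end_mono) simp
    with that \<open>active t\<close> show False
      by (simp add: active_def)
  qed
  have round_eq: "round_law D t = round_law D' t" if t: "t \<in> {1..T}" "\<not> active t" for t
  proof -
    have "batch_sum B x D (batch_of B t) h = batch_sum B x D' (batch_of B t) h"
      if "t = batch_end B (batch_of B t)" for h
      unfolding batch_sum_def using that t t0(2) by (intro sum.cong) (force simp: active_def)+
    then have "update_law D t = update_law D' t"
      by (cases "t = batch_end B (batch_of B t)") (simp_all add: ts_update_def)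
    then show ?thesis
      by (simp add: ts_round_eq)
  qed
  have round_dp: "dp_le (ennreal (exp \<epsilon>)) (ennreal \<delta>) (round_law D t s) (round_law D' t s)"
    if t: "t \<in> {1..T}" and s: "s \<in> space (S (t - 1))" for t s
  proof (rule dp_le_round[OF t s], rule dp_le_update[OF t], assumption, rule norm_batch_sum_diff_le)
    fix i assume "t = batch_end B (batch_of B t)"
      and "i \<in> {batch_end B (batch_of B t - 1)<..batch_end B (batch_of B t)}"
    then have "i \<in> {1..T}"
      using t by auto
    then show "i \<noteq> t0 \<Longrightarrow> D i = D' i" "snd (D i) \<in> {0..1} \<and> snd (D' i) \<in> {0..1}"
      using t0(2) r by auto
  qed
  have "state_law D t = state_law D' t \<or>
      (\<exists>s\<le>t. active s) \<and> dp_le (ennreal (exp \<epsilon>)) (ennreal \<delta>) (state_law D t) (state_law D' t)"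
    if "t \<le> T" for t
    using that
  proof (induction t)
    case 0
    show ?case by simp
  next
    case (Suc t)
    then have t: "t \<le> T" "Suc t \<in> {1..T}"
      by simp_all
    note law = state_law_in_prob_algebra[OF t(1), of D] state_law_in_prob_algebra[OF t(1), of D']
    note kernel = round_measurable[OF t(2), simplified diff_Suc_1]
    consider "state_law D t = state_law D' t" "active (Suc t)"
      | "state_law D t = state_law D' t" "\<not> active (Suc t)"
      | s where "s \<le> t" "active s"
          "dp_le (ennreal (exp \<epsilon>)) (ennreal \<delta>) (state_law D t) (state_law D' t)"
      using Suc.IH[OF t(1)] by blast
    then show ?case
    proof cases
      case 1
      then show ?thesis
        using dp_le_bind_kernels[OF law(2) kernel[of D] kernel[of D'] round_dp[OF t(2)]] by auto
    next
      case 2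
      then show ?thesis
        using round_eq[OF t(2)] by simp
    next
      case 3
      then have "\<not> active (Suc t)"
        using active_unique[of s "Suc t"] by simp
      then show ?thesis
        using 3 dp_le_bind_same_kernel[OF law kernel[of D'] 3(3)] round_eq[OF t(2)]
        by (auto intro: le_SucI)
    qed
  qed
  from this[of T] show ?thesis
    using dp_le_refl[of "ennreal (exp \<epsilon>)"] params by auto
qed

end

theorem theorem6:
  fixes \<epsilon> \<delta> l v0 \<gamma> :: real
    and T K :: nat
    and B :: "nat \<Rightarrow> nat"
    and \<theta>0 :: "real ^ 'd"
    and C :: "nat \<Rightarrow> 'a measure"
    and x :: "nat \<Rightarrow> 'a \<Rightarrow> real ^ 'd"
    and sel :: "nat \<Rightarrow> (nat \<Rightarrow> 'a) \<times> (real ^ 'd) \<Rightarrow> 'a measure"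
    and D D' :: "nat \<Rightarrow> 'u \<times> real"
    and E :: "(nat \<Rightarrow> 'a) set"
  assumes "\<epsilon> > 0" and "0 < \<delta>" and "\<delta> < 1"
    and "l > 0" and "v0 > 0" and "\<gamma> > 0"
    and "\<And>k. k \<in> {1..K} \<Longrightarrow> B k \<ge> 1" and "batch_end B K = T"
    and "\<And>t. t \<in> {1..T} \<Longrightarrow> x t \<in> borel_measurable (C t)"
    and "\<And>t. t \<in> {1..T} \<Longrightarrow> sel t \<in> measurable (PiM {1..<t} C \<Otimes>\<^sub>M borel) (prob_algebra (C t))"
    and "\<And>t h \<theta>. t \<in> {1..T} \<Longrightarrow> h \<in> space (PiM {1..<t} C) \<Longrightarrow>
           AE a in sel t (h, \<theta>).
             is_arg_max (\<lambda>a. clip (x t a) \<bullet> \<theta>) (\<lambda>a. a \<in> space (C t)) a"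
    and "\<And>t. t \<in> {1..T} \<Longrightarrow> snd (D t) \<in> {0..1}"
    and "\<And>t. t \<in> {1..T} \<Longrightarrow> snd (D' t) \<in> {0..1}"
    and "adjacent T D D'"
    and "E \<in> sets (PiM {1..T} C)"
  shows "measure (ts_transcript \<epsilon> \<delta> C x sel l \<theta>0 (\<lambda>k. v0 * \<gamma> ^ (k - 1)) B T D) E
       \<le> exp \<epsilon> * measure (ts_transcript \<epsilon> \<delta> C x sel l \<theta>0 (\<lambda>k. v0 * \<gamma> ^ (k - 1)) B T D') E + \<delta>"
proof -
  interpret ts_instance \<epsilon> \<delta> l C x sel \<theta>0 "\<lambda>k. v0 * \<gamma> ^ (k - 1)" B T
    using assms by unfold_locales simp_all
  let ?R = "PiM {1..T} C"
  let ?F = "fst -` E \<inter> space (S T)"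
  have fst: "fst \<in> S T \<rightarrow>\<^sub>M ?R"
    unfolding state_space_def by measurable
  have F: "?F \<in> sets (S T)"
    by (rule measurable_sets[OF fst assms(15)])
  have law: "state_law D'' T \<in> space (prob_algebra (S T))" for D'' :: "nat \<Rightarrow> 'u \<times> real"
    by (rule state_law_in_prob_algebra) simp
  note sets = prob_algebraD(2)[OF law] and space = prob_algebraD(3)[OF law]
  have F': "?F \<in> sets (state_law D'' T)" for D'' :: "nat \<Rightarrow> 'u \<times> real"
    unfolding sets by (rule F)
  have indicator_le_one: "indicator ?F s \<le> (1 :: ennreal)" for s
    by (simp add: indicator_def)
  have transcript: "measure (ts_transcript \<epsilon> \<delta> C x sel l \<theta>0 (\<lambda>k. v0 * \<gamma> ^ (k - 1)) B T D'') E
      = measure (state_law D'' T) ?F" for D'' :: "nat \<Rightarrow> 'u \<times> real"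
    unfolding ts_transcript_def using fst assms(15)
    by (subst measure_distr) (simp_all add: space sets del: One_nat_def cong: measurable_cong_sets)
  have emeasure: "emeasure (state_law D'' T) ?F = ennreal (measure (state_law D'' T) ?F)"
    for D'' :: "nat \<Rightarrow> 'u \<times> real"
  proof -
    interpret prob_space "state_law D'' T" by (rule prob_algebraD(1)[OF law])
    show ?thesis by (rule emeasure_eq_measure)
  qed
  have "dp_le (ennreal (exp \<epsilon>)) (ennreal \<delta>) (state_law D T) (state_law D' T)"
    using assms by (intro dp_le_state_law) auto
  from dp_leD[OF this borel_measurable_indicator[OF F'[of D]] indicator_le_one]
  have "emeasure (state_law D T) ?F \<le> ennreal (exp \<epsilon>) * emeasure (state_law D' T) ?F + ennreal \<delta>"
    by (simp only: nn_integral_indicator F')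
  then have "ennreal (measure (state_law D T) ?F)
      \<le> ennreal (exp \<epsilon> * measure (state_law D' T) ?F + \<delta>)"
    using params by (simp add: emeasure ennreal_mult del: One_nat_def)
  then show ?thesis
    unfolding transcript using params(2) by (subst (asm) ennreal_le_iff) simp_all
qed

end
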